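(* For every $\alpha\in[0,1]$ and every $\lambda\in\mathbb{C}$, $$\max_{f\in\mathfrak{R}_\alpha}|\Phi(f,\lambda)|=\max\left\{\frac{1}{3-2\alpha},\ |\lambda-1|\right\}.$$
   Context: Let $\mathbb{D}$ be the open unit disk. $\mathcal{A}$ is the set of holomorphic $f:\mathbb{D}\to\mathbb{C}$ with $f(0)=0$, $f'(0)=1$. For $f\in\mathcal{A}$ with $f(z)=z+\sum_{n\ge2}a_nz^n$ and $\lambda\in\mathbb{C}$, the Fekete–Szegő functional is $\Phi(f,\lambda)=a_3-\lambda a_2^2$. For $0\le\alpha<1$, $\mathcal{S}^*(\alpha)=\{f\in\mathcal{A}:\operatorname{Re}\frac{zf'(z)}{f(z)}\ge\alpha,\ z\in\mathbb{D}\}$. For $f=\sum a_nz^n$, $g=\sum b_nz^n$, the Hadamard product is $f*g=\sum a_nb_nz^n$. For $\alpha\in[0,1)$, $\mathfrak{R}_\alpha$ (prestarlike functions of order $\alpha$) is the set of $f\in\mathcal{A}$ with $f(z)*\frac{z}{(1-z)^{2-2\alpha}}\in\mathcal{S}^*(\alpha)$; and $\mathfrak{R}_1=\{f\in\mathcal{A}:\operatorname{Re}\frac{f(z)}{z}>\frac12,\ z\in\mathbb{D}\setminus\{0\}\}$. *)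

theory Defs
  imports "HOL-Complex_Analysis.Complex_Analysis"
begin

abbreviation unit_disk :: "complex set" ("\<bbbD>") where
  "\<bbbD> \<equiv> ball 0 1"

text \<open>
  Functions on the disk are total functions of which only the values on \<open>\<bbbD>\<close> matter.
\<close>

definition class_A :: "(complex \<Rightarrow> complex) set" where
  "class_A = {f. f holomorphic_on \<bbbD> \<and> f 0 = 0 \<and> deriv f 0 = 1}"

definition taylor_coeff :: "(complex \<Rightarrow> complex) \<Rightarrow> nat \<Rightarrow> complex" where
  "taylor_coeff f n = fps_nth (fps_expansion f 0) n"

definition fekete_szego :: "(complex \<Rightarrow> complex) \<Rightarrow> complex \<Rightarrow> complex" where
  "fekete_szego f lam = taylor_coeff f 3 - lam * (taylor_coeff f 2)\<^sup>2"

definition hadamard_prod ::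
    "(complex \<Rightarrow> complex) \<Rightarrow> (complex \<Rightarrow> complex) \<Rightarrow> complex \<Rightarrow> complex" where
  "hadamard_prod f g z = (\<Sum>n. taylor_coeff f n * taylor_coeff g n * z ^ n)"

text \<open>
  The condition on \<open>z f'(z) / f(z)\<close> presupposes that the quotient is defined, which
  \<open>x / 0 = 0\<close> would hide: for \<open>\<alpha> = 0\<close> a zero of \<open>f\<close> would pass the inequality.  Hence
  \<open>f z \<noteq> 0\<close> is demanded off the origin.  At the origin the singularity is removable with
  value 1, and the inequality there reads \<open>\<alpha> \<le> 1\<close>, so this point is left out.
\<close>

definition starlike_order :: "real \<Rightarrow> (complex \<Rightarrow> complex) set" where
  "starlike_order \<alpha> =
     {f \<in> class_A. \<forall>z\<in>\<bbbD> - {0}. f z \<noteq> 0 \<and> Re (z * deriv f z / f z) \<ge> \<alpha>}"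

text \<open>
  The power of \<open>1 - z\<close> is the principal one, holomorphic on \<open>\<bbbD>\<close> as \<open>Re (1 - z) > 0\<close> there.
  The set is only meant for \<open>0 \<le> \<alpha> \<le> 1\<close>.
\<close>

definition prestarlike :: "real \<Rightarrow> (complex \<Rightarrow> complex) set" where
  "prestarlike \<alpha> =
     (if \<alpha> = 1 then {f \<in> class_A. \<forall>z\<in>\<bbbD> - {0}. Re (f z / z) > 1 / 2}
      else {f \<in> class_A.
              hadamard_prod f (\<lambda>z. z / (1 - z) powr complex_of_real (2 - 2 * \<alpha>))
                \<in> starlike_order \<alpha>})"

end

theory Submission
  imports Defs
begin

text \<open>
  Everything rests on \<open>(3 - 2 * \<alpha>) * \<bar>a\<^sub>3 - a\<^sub>2\<^sup>2\<bar> \<le> 1 - \<bar>a\<^sub>2\<bar>\<^sup>2\<close> for prestarlike functions of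
  order \<open>\<alpha>\<close>.  Starlikeness of the Hadamard product means that \<open>z h' / h = \<alpha> + (1 - \<alpha>) p\<close> with
  \<open>Re p \<ge> 0\<close>; writing \<open>p = (1 + z \<phi>) / (1 - z \<phi>)\<close> with \<open>\<bar>\<phi>\<bar> \<le> 1\<close>, a comparison of coefficients gives
  \<open>a\<^sub>2 = \<phi> 0\<close> and \<open>a\<^sub>3 - a\<^sub>2\<^sup>2 = \<phi>' 0 / (3 - 2 * \<alpha>)\<close>, and the inequality is the one of Schwarz and Pick at \<open>0\<close>.
  Hence \<open>\<Phi>(f, \<lambda>)\<close> is bounded by a convex combination of \<open>1 / (3 - 2 * \<alpha>)\<close> and \<open>\<bar>\<lambda> - 1\<bar>\<close>; the choices
  \<open>\<phi> = 1\<close> and \<open>\<phi> = z\<close> attain the two end points.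
\<close>

section \<open>Taylor coefficients and power series on the disk\<close>

lemma taylor_coeff_eqI: "f has_fps_expansion F \<Longrightarrow> taylor_coeff f n = fps_nth F n"
  by (simp add: taylor_coeff_def fps_expansion_eqI)

lemma has_fps_expansion_taylor:
  assumes "f holomorphic_on \<bbbD>"
  shows "f has_fps_expansion Abs_fps (taylor_coeff f)"
proof -
  have "Abs_fps (taylor_coeff f) = fps_expansion f 0"
    by (simp add: fps_eq_iff taylor_coeff_def)
  then show ?thesis
    using has_fps_expansion_fps_expansion[of "\<bbbD>" f] assms by simp
qed

lemma taylor_coeff_0: "taylor_coeff f 0 = f 0"
  and taylor_coeff_1: "taylor_coeff f 1 = deriv f 0"
  by (simp_all add: taylor_coeff_def fps_expansion_def)

lemma eventually_nhds_disk: "(\<And>z. z \<in> \<bbbD> \<Longrightarrow> P z) \<Longrightarrow> eventually P (nhds 0)"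
  by (rule eventually_nhds_in_open[THEN eventually_mono, of "\<bbbD>"]) auto

text \<open>Turns functional equations on the disk into equations of power series, from which
  coefficients are then compared.\<close>

lemma fps_eq_on_disk:
  assumes "f has_fps_expansion F" "g has_fps_expansion G" "\<And>z. z \<in> \<bbbD> \<Longrightarrow> f z = g z"
  shows "F = G"
proof (rule fps_expansion_unique_complex)
  show "f has_fps_expansion G"
    using assms eventually_nhds_disk[of "\<lambda>z. f z = g z"] has_fps_expansion_cong by blast
qed (fact assms)

section \<open>Schwarz and Schwarz-Pick estimates under a non-strict bound\<close>

text \<open>The Schwarz lemma applies to \<open>t * f\<close> for every \<open>t\<close> in (0, 1),
  as this function is strictly bounded by 1; no such \<open>t\<close> affects the right-hand
  side.\<close>

lemma Schwarz_bounded: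
  assumes holf: "f holomorphic_on \<bbbD>" and f0: "f 0 = 0"
    and le: "\<And>z. z \<in> \<bbbD> \<Longrightarrow> norm (f z) \<le> 1" and z: "z \<in> \<bbbD>"
  shows "norm (f z) \<le> norm z"
proof (rule field_le_mult_one_interval)
  fix t :: real assume t: "0 < t" "t < 1"
  have "norm (of_real t * f z) \<le> norm z"
  proof (rule Schwarz_Lemma(1))
    show "(\<lambda>z. of_real t * f z) holomorphic_on \<bbbD>"
      by (intro holomorphic_intros holf)
    show "norm (of_real t * f w) < 1" if "norm w < 1" for w
    proof -
      have "norm (of_real t * f w) \<le> t * 1"
        using le[of w] that t unfolding norm_mult by (intro mult_mono) auto
      with t show ?thesis by linarith
    qed
  qed (use f0 z in auto)
  with t show "t * norm (f z) \<le> norm z"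
    by (simp add: norm_mult)
qed

text \<open>The disk automorphism sending \<open>w\<close> to 0 has derivative
  \<open>1 / (1 - (norm w)^2)\<close> at \<open>w\<close>. After composition with it the value at 0
  vanishes, and the Schwarz lemma bounds the derivative by 1.\<close>

lemma Schwarz_Pick_at_0:
  assumes holf: "f holomorphic_on \<bbbD>" and le: "\<And>z. z \<in> \<bbbD> \<Longrightarrow> norm (f z) \<le> 1"
  shows "norm (deriv f 0) \<le> 1 - (norm (f 0))\<^sup>2"
proof -
  \<comment> \<open>Shrinking \<open>f\<close> by a factor \<open>t < 1\<close> avoids treating unimodular constants separately.\<close>
  have *: "t * norm (deriv f 0) \<le> 1 - (t * norm (f 0))\<^sup>2" if t: "0 < t" "t < 1" for t
  proof -
    define w where "w = of_real t * f 0"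
    define F where "F = (\<lambda>z. Moebius_function 0 w (of_real t * f z))"
    have lt: "norm (of_real t * f z) < 1" if "norm z < 1" for z
    proof -
      have "norm (of_real t * f z) \<le> t * 1"
        using le[of z] that t unfolding norm_mult by (intro mult_mono) auto
      with t show ?thesis by linarith
    qed
    have w: "norm w < 1"
      using lt[of 0] by (simp add: w_def)
    have w2: "(norm w)\<^sup>2 < 1"
      using w by (simp add: abs_square_less_1)
    have eq: "1 - cnj w * w = of_real (1 - (norm w)\<^sup>2)"
      by (simp only: of_real_diff of_real_1 complex_norm_square mult.commute)
    have "1 - cnj w * w \<noteq> 0"
      unfolding eq of_real_eq_0_iff using w2 by simp
    then have nz: "cnj w * w \<noteq> 1"
      by simp
    have "norm (deriv F 0) \<le> 1"
    proof (rule Schwarz_Lemma(2))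
      have "Moebius_function 0 w \<circ> (\<lambda>z. of_real t * f z) holomorphic_on \<bbbD>"
        by (rule holomorphic_on_compose_gen[OF _ Moebius_function_holomorphic[OF w]])
           (use lt in \<open>auto intro!: holomorphic_intros holf\<close>)
      then show "F holomorphic_on \<bbbD>"
        by (simp add: F_def o_def)
      show "F 0 = 0"
        by (simp add: F_def w_def Moebius_function_eq_zero)
      show "norm (F z) < 1" if "norm z < 1" for z
        using Moebius_function_norm_lt_1[OF w lt[OF that]] by (simp add: F_def)
    \<comment> \<open>The remaining premise of \<open>Schwarz_Lemma\<close> asks for a point of the
      disk that the conclusion does not mention; 0 serves.\<close>
    qed (rule norm_zero[THEN ord_eq_less_trans], simp)
    moreover have "deriv F 0 = of_real t * deriv f 0 / (1 - cnj w * w)"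
    proof (rule DERIV_imp_deriv)
      have "(f has_field_derivative deriv f 0) (at 0)"
        by (rule holomorphic_derivI[OF holf]) auto
      then show "(F has_field_derivative of_real t * deriv f 0 / (1 - cnj w * w)) (at 0)"
        unfolding F_def Moebius_function_simple
        by (auto intro!: derivative_eq_intros simp: nz w_def[symmetric])
    qed
    ultimately have "t * norm (deriv f 0) / (1 - (norm w)\<^sup>2) \<le> 1"
      using t w2 unfolding eq by (simp add: norm_divide norm_mult del: of_real_diff of_real_power)
    then show ?thesis
      using w2 t by (simp add: w_def norm_mult field_simps)
  qed
  show ?thesis
  proof (rule tendsto_le[OF trivial_limit_at_left_real])
    show "((\<lambda>t. t * norm (deriv f 0)) \<longlongrightarrow> norm (deriv f 0)) (at_left 1)"
      by (auto intro!: tendsto_eq_intros)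
    show "((\<lambda>t. 1 - (t * norm (f 0))\<^sup>2) \<longlongrightarrow> 1 - (norm (f 0))\<^sup>2) (at_left 1)"
      by (auto intro!: tendsto_eq_intros)
    show "\<forall>\<^sub>F t in at_left 1. t * norm (deriv f 0) \<le> 1 - (t * norm (f 0))\<^sup>2"
      using eventually_at_left_real[OF zero_less_one] by eventually_elim (use * in auto)
  qed
qed

section \<open>Coefficients of Caratheodory and starlike functions\<close>

text \<open>The Cayley transform of \<open>p\<close> maps into the closed unit disk and vanishes at
  0, so it is z times a function \<open>\<phi>\<close> bounded by 1. The parameters are
  \<open>w = \<phi> 0\<close> and \<open>v = deriv \<phi> 0\<close>, related by
  Schwarz-Pick.\<close>

lemma Caratheodory_coeffs:
  assumes holp: "p holomorphic_on \<bbbD>" and p0: "p 0 = 1"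
    and Re: "\<And>z. z \<in> \<bbbD> \<Longrightarrow> Re (p z) \<ge> 0"
  obtains w v where "norm v \<le> 1 - (norm w)\<^sup>2"
    "taylor_coeff p 1 = 2 * w" "taylor_coeff p 2 = 2 * (v + w\<^sup>2)"
proof -
  define \<omega> where "\<omega> = (\<lambda>z. (p z - 1) / (p z + 1))"
  have nz: "p z + 1 \<noteq> 0" if "z \<in> \<bbbD>" for z
    using Re[OF that] by (auto simp: complex_eq_iff)
  have hol: "\<omega> holomorphic_on \<bbbD>"
    unfolding \<omega>_def by (intro holomorphic_intros holp) (use nz in auto)
  have \<omega>0: "\<omega> 0 = 0"
    by (simp add: \<omega>_def p0)
  have le: "norm (\<omega> z) \<le> 1" if "z \<in> \<bbbD>" for z
  proof -
    have "(norm (p z - 1))\<^sup>2 \<le> (norm (p z + 1))\<^sup>2"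
      using Re[OF that] unfolding cmod_power2 by (simp add: power2_eq_square algebra_simps)
    then have "norm (p z - 1) \<le> norm (p z + 1)"
      by (rule power2_le_imp_le) simp
    then show ?thesis
      using nz[OF that] by (simp add: \<omega>_def norm_divide)
  qed
  obtain \<phi> where hol\<phi>: "\<phi> holomorphic_on \<bbbD>"
    and \<phi>: "\<And>z. norm z < 1 \<Longrightarrow> \<omega> z = z * \<phi> z" and d: "deriv \<omega> 0 = \<phi> 0"
    using Schwarz3[OF hol \<omega>0] by blast
  have \<phi>le: "norm (\<phi> z) \<le> 1" if z: "z \<in> \<bbbD>" for z
  proof (cases "z = 0")
    case True
    \<comment> \<open>At the origin \<open>\<phi>\<close> takes the value
      \<open>deriv \<omega> 0\<close>, which Schwarz-Pick bounds by 1 since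
      \<open>\<omega> 0 = 0\<close>.\<close>
    then show ?thesis
      using Schwarz_Pick_at_0[OF hol le] by (simp add: \<omega>0 d)
  next
    case False
    have "norm z * norm (\<phi> z) \<le> norm z * 1"
      using Schwarz_bounded[OF hol \<omega>0 le z] \<phi>[of z] z by (simp add: norm_mult)
    with False show ?thesis
      by simp
  qed
  define P where "P = Abs_fps (taylor_coeff p)"
  define \<Phi> where "\<Phi> = Abs_fps (taylor_coeff \<phi>)"
  note ex [fps_expansion_intros] = has_fps_expansion_taylor[OF holp, folded P_def]
    has_fps_expansion_taylor[OF hol\<phi>, folded \<Phi>_def]
  \<comment> \<open>This is \<open>p - 1 = z \<phi> (p + 1)\<close>, the definition of
    \<open>\<omega>\<close> without its denominator. The factor z makes it a recursion for the
    coefficients of \<open>p\<close>.\<close>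
  have "P = 1 + fps_X * (\<Phi> + P * \<Phi>)"
  proof (rule fps_eq_on_disk[OF ex(1)])
    show "(\<lambda>z. 1 + z * (\<phi> z + p z * \<phi> z)) has_fps_expansion 1 + fps_X * (\<Phi> + P * \<Phi>)"
      by (intro fps_expansion_intros)
    show "p z = 1 + z * (\<phi> z + p z * \<phi> z)" if "z \<in> \<bbbD>" for z
    proof -
      have "p z - 1 = (z * \<phi> z) * (p z + 1)"
        using \<phi>[of z] that nz[OF that] by (simp add: \<omega>_def field_simps)
      then show ?thesis
        by (simp add: algebra_simps)
    qed
  qed
  then have nth: "fps_nth P n = fps_nth (1 + fps_X * (\<Phi> + P * \<Phi>)) n" for n
    by simp
  have P0: "taylor_coeff p 0 = 1"
    by (simp add: taylor_coeff_0 p0)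
  have P1: "taylor_coeff p (Suc 0) = 2 * \<phi> 0"
    using nth[of 1] P0 by (simp add: P_def \<Phi>_def taylor_coeff_0)
  have P2: "taylor_coeff p 2 = 2 * (deriv \<phi> 0 + (\<phi> 0)\<^sup>2)"
    using nth[of 2] P0 P1 taylor_coeff_1[of \<phi>]
    by (simp add: P_def \<Phi>_def taylor_coeff_0 fps_mult_nth numeral_2_eq_2 power2_eq_square)
  show ?thesis
    using that[OF Schwarz_Pick_at_0[OF hol\<phi> \<phi>le]] P1 P2 by simp
qed

text \<open>Writing \<open>z h' / h = \<alpha> + (1 - \<alpha>) p\<close> gives a Caratheodory
  function \<open>p\<close>; its first two coefficients determine those of \<open>h\<close> through
  \<open>z h' = h (\<alpha> + (1 - \<alpha>) p)\<close>.\<close>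

lemma starlike_order_coeffs:
  assumes h: "h \<in> starlike_order \<alpha>" and \<alpha>: "\<alpha> < 1"
  obtains w v where "norm v \<le> 1 - (norm w)\<^sup>2"
    "taylor_coeff h 2 = 2 * of_real (1 - \<alpha>) * w"
    "taylor_coeff h 3 = of_real (1 - \<alpha>) * (v + (1 + 2 * of_real (1 - \<alpha>)) * w\<^sup>2)"
proof -
  have hol: "h holomorphic_on \<bbbD>" and h0: "h 0 = 0" and h1: "deriv h 0 = 1"
    and star: "\<And>z. z \<in> \<bbbD> - {0} \<Longrightarrow> h z \<noteq> 0 \<and> Re (z * deriv h z / h z) \<ge> \<alpha>"
    using h by (auto simp: starlike_order_def class_A_def)
  define \<beta> :: complex where "\<beta> = of_real (1 - \<alpha>)"
  have \<beta>: "\<beta> \<noteq> 0"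
    using \<alpha> unfolding \<beta>_def by (subst of_real_eq_0_iff) simp
  obtain q where holq: "q holomorphic_on \<bbbD>"
    and q: "\<And>z. norm z < 1 \<Longrightarrow> h z = z * q z" and "deriv h 0 = q 0"
    using Schwarz3[OF hol h0] by blast
  then have q0: "q 0 = 1"
    using h1 by simp
  have qnz: "q z \<noteq> 0" if "z \<in> \<bbbD>" for z
    using star[of z] q[of z] that q0 by (cases "z = 0") auto
  \<comment> \<open>With \<open>h = z q\<close> one has \<open>z h' / h = 1 + z q' / q\<close>.
    Solving for \<open>p\<close> in terms of the zero-free \<open>q\<close> avoids the removable
    singularity at 0.\<close>
  define p where "p = (\<lambda>z. 1 + z * deriv q z / (\<beta> * q z))"
  have holp: "p holomorphic_on \<bbbD>"
    unfolding p_def by (intro holomorphic_intros holq) (use qnz \<beta> in auto)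
  have eq: "z * deriv h z = h z * (1 - \<beta> + \<beta> * p z)" if "z \<in> \<bbbD>" for z
  proof -
    have "(q has_field_derivative deriv q z) (at z)"
      by (rule holomorphic_derivI[OF holq]) (use that in auto)
    then have "((\<lambda>z. z * q z) has_field_derivative q z + z * deriv q z) (at z)"
      by (auto intro!: derivative_eq_intros)
    then have "(h has_field_derivative q z + z * deriv q z) (at z)"
      by (rule has_field_derivative_transform_within_open[of _ _ _ "\<bbbD>"]) (use that q in auto)
    then have "deriv h z = q z + z * deriv q z"
      by (rule DERIV_imp_deriv)
    then show ?thesis
      using that q[of z] qnz[OF that] \<beta> by (simp add: p_def field_simps)
  qed
  have Re: "Re (p z) \<ge> 0" if "z \<in> \<bbbD>" for z
  proof (cases "z = 0")
    case False
    then have "z * deriv h z / h z = 1 - \<beta> + \<beta> * p z"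
      using eq[OF that] star[of z] that by simp
    then have "(1 - \<alpha>) * Re (p z) \<ge> 0"
      using star[of z] that False by (simp add: \<beta>_def)
    then show ?thesis
      using \<alpha> by (simp add: zero_le_mult_iff)
  qed (simp add: p_def)
  obtain w v where wv: "norm v \<le> 1 - (norm w)\<^sup>2"
    "taylor_coeff p 1 = 2 * w" "taylor_coeff p 2 = 2 * (v + w\<^sup>2)"
    by (rule Caratheodory_coeffs[OF holp _ Re]) (simp_all add: p_def)
  define H where "H = Abs_fps (taylor_coeff h)"
  define P where "P = Abs_fps (taylor_coeff p)"
  note ex [fps_expansion_intros] = has_fps_expansion_taylor[OF hol, folded H_def]
    has_fps_expansion_taylor[OF holp, folded P_def]
  have "fps_X * fps_deriv H = H * (1 - fps_const \<beta> + fps_const \<beta> * P)"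
  proof (rule fps_eq_on_disk[OF _ _ eq])
    show "(\<lambda>z. z * deriv h z) has_fps_expansion fps_X * fps_deriv H"
      by (intro fps_expansion_intros)
    show "(\<lambda>z. h z * (1 - \<beta> + \<beta> * p z)) has_fps_expansion H * (1 - fps_const \<beta> + fps_const \<beta> * P)"
      by (intro fps_expansion_intros)
  qed
  then have nth: "fps_nth (fps_X * fps_deriv H) n
      = fps_nth (H * (1 - fps_const \<beta> + fps_const \<beta> * P)) n" for n
    by simp
  have c: "taylor_coeff h 0 = 0" "taylor_coeff h (Suc 0) = 1"
    "taylor_coeff p 0 = 1" "taylor_coeff p (Suc 0) = 2 * w"
    using h0 h1 wv taylor_coeff_1[of h] by (simp_all add: taylor_coeff_0 p_def)
  have H2: "taylor_coeff h 2 = 2 * \<beta> * w"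
    using nth[of 2] c
    by (simp add: H_def P_def fps_mult_nth numeral_2_eq_2 algebra_simps)
  \<comment> \<open>The coefficient of z^3 occurs three times on the left and once on the right of
    the differential equation, whence the factor 2.\<close>
  have "2 * taylor_coeff h 3 = 2 * (\<beta> * (v + (1 + 2 * \<beta>) * w\<^sup>2))"
    using nth[of 3] c H2 wv(3)
    by (simp add: H_def P_def fps_mult_nth numeral_2_eq_2 numeral_3_eq_3 algebra_simps)
  then have "taylor_coeff h 3 = \<beta> * (v + (1 + 2 * \<beta>) * w\<^sup>2)"
    by (simp only: mult_cancel_left) simp
  with wv(1) H2 show ?thesis
    using that unfolding \<beta>_def by blast
qed

section \<open>Hadamard products and the generalized Koebe function\<close>

text \<open>The product series must be shown to converge near 0. For \<open>r\<close> below both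
  radii, the terms of \<open>F\<close> at \<open>r\<close> are absolutely summable and those of
  \<open>G\<close> are bounded by some \<open>M\<close>, so the product series converges at
  \<open>r^2\<close>.\<close>

lemma taylor_coeff_hadamard_prod:
  assumes "f has_fps_expansion F" "g has_fps_expansion G"
  shows "taylor_coeff (hadamard_prod f g) n = fps_nth F n * fps_nth G n"
proof -
  define H where "H = Abs_fps (\<lambda>n. fps_nth F n * fps_nth G n)"
  have "\<exists>r>0. ereal r < fps_conv_radius F \<and> ereal r < fps_conv_radius G"
  proof -
    have "0 < min (fps_conv_radius F) (fps_conv_radius G)"
      using assms by (auto simp: has_fps_expansion_def)
    then show ?thesis
      using ereal_dense2[of 0 "min (fps_conv_radius F) (fps_conv_radius G)"]
      by (auto simp: zero_ereal_def)
  qed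
  then obtain r where r: "r > 0" "ereal r < fps_conv_radius F" "ereal r < fps_conv_radius G"
    by blast
  have sF: "summable (\<lambda>n. norm (fps_nth F n * of_real r ^ n))"
    using norm_summable_fps[of "of_real r" F] r by simp
  have "(\<lambda>n. fps_nth G n * of_real r ^ n) \<longlonglongrightarrow> 0"
    using summable_LIMSEQ_zero summable_fps[of "of_real r" G] r by simp
  then obtain M where M: "\<And>n. norm (fps_nth G n * of_real r ^ n) \<le> M"
    using convergent_imp_Bseq[of "\<lambda>n. fps_nth G n * of_real r ^ n"]
    by (auto simp: convergent_def Bseq_def)
  have "summable (\<lambda>n. fps_nth H n * (of_real (r\<^sup>2)) ^ n)"
  proof (rule summable_norm_cancel, rule summable_comparison_test')
    show "summable (\<lambda>n. norm (fps_nth F n * of_real r ^ n) * M)"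
      by (rule summable_mult2[OF sF])
    show "norm (norm (fps_nth H n * of_real (r\<^sup>2) ^ n)) \<le> norm (fps_nth F n * of_real r ^ n) * M" for n
    proof -
      have "norm (fps_nth H n * of_real (r\<^sup>2) ^ n)
          = norm (fps_nth F n * of_real r ^ n) * norm (fps_nth G n * of_real r ^ n)"
        by (simp add: H_def norm_mult norm_power power_mult_distrib power2_eq_square)
      also have "\<dots> \<le> norm (fps_nth F n * of_real r ^ n) * M"
        by (intro mult_left_mono M) simp
      finally show ?thesis by simp
    qed
  qed
  then have "fps_conv_radius H \<ge> norm (of_real (r\<^sup>2) :: complex)"
    unfolding fps_conv_radius_def by (rule conv_radius_geI)
  moreover have "norm (of_real (r\<^sup>2) :: complex) > 0"
    using r by simp
  ultimately have "fps_conv_radius H > 0"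
    by (metis ereal_less(2) less_le_trans)
  moreover have "hadamard_prod f g = eval_fps H"
    by (simp add: hadamard_prod_def eval_fps_def H_def taylor_coeff_eqI[OF assms(1)]
        taylor_coeff_eqI[OF assms(2)] fun_eq_iff)
  ultimately have "hadamard_prod f g has_fps_expansion H"
    by (simp add: eval_fps_has_fps_expansion)
  then show ?thesis
    by (simp add: taylor_coeff_eqI H_def)
qed

text \<open>The binomial series for exponent \<open>- c\<close> at \<open>- z\<close>; the two
  alternating signs cancel and leave a Pochhammer quotient.\<close>

lemma one_minus_powr_sums:
  fixes c z :: complex
  assumes "norm z < 1"
  shows "(\<lambda>n. pochhammer c n / fact n * z ^ n) sums (1 - z) powr (- c)"
proof -
  have "(- c gchoose n) * (- z) ^ n = pochhammer c n / fact n * z ^ n" for n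
    by (cases "even n") (simp_all add: gbinomial_pochhammer)
  then show ?thesis
    using gen_binomial_complex[of "- z" "- c"] assms by simp
qed

text \<open>The series of the generalized Koebe function \<open>z / (1 - z) powr c\<close>; for
  \<open>c = 2\<close> this is the classical one.\<close>

definition koebe_fps :: "complex \<Rightarrow> complex fps" where
  "koebe_fps c = fps_X * Abs_fps (\<lambda>n. pochhammer c n / fact n)"

lemma has_fps_expansion_koebe: "(\<lambda>z. z / (1 - z) powr c) has_fps_expansion koebe_fps c"
proof -
  have "(\<lambda>z. (1 - z) powr (- c)) has_fps_expansion Abs_fps (\<lambda>n. pochhammer c n / fact n)"
    by (rule has_fps_expansionI, rule eventually_nhds_disk) (use one_minus_powr_sums[of _ c] in simp)
  then have "(\<lambda>z. z * (1 - z) powr (- c)) has_fps_expansion koebe_fps c"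
    unfolding koebe_fps_def by (intro fps_expansion_intros)
  then show ?thesis
    by (simp add: powr_minus divide_inverse)
qed

lemma koebe_fps_nth [simp]:
  "fps_nth (koebe_fps c) 0 = 0" "fps_nth (koebe_fps c) (Suc n) = pochhammer c n / fact n"
  by (simp_all add: koebe_fps_def)

lemma koebe_fps_nth_2: "fps_nth (koebe_fps c) 2 = c"
  and koebe_fps_nth_3: "fps_nth (koebe_fps c) 3 = c * (c + 1) / 2"
  using koebe_fps_nth(2)[of c 1] koebe_fps_nth(2)[of c 2]
  by (simp_all add: numeral_2_eq_2 numeral_3_eq_3 pochhammer_Suc)

section \<open>The coefficient inequality for prestarlike functions\<close>

text \<open>Both cases of the definition lead to the same parametrization by \<open>w\<close> and
  \<open>v\<close>. For \<open>\<alpha> < 1\<close> it comes from dividing the coefficients of a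
  starlike function by those of the kernel, for \<open>\<alpha> = 1\<close> directly from a
  Caratheodory function.\<close>

lemma prestarlike_coeffs:
  assumes f: "f \<in> prestarlike \<alpha>" and \<alpha>: "\<alpha> \<le> 1"
  shows "norm (taylor_coeff f 3 - (taylor_coeff f 2)\<^sup>2)
    \<le> (1 - (norm (taylor_coeff f 2))\<^sup>2) / (3 - 2 * \<alpha>)"
proof -
  have hol: "f holomorphic_on \<bbbD>" and f0: "f 0 = 0" and f1: "deriv f 0 = 1"
    using f by (auto simp: prestarlike_def class_A_def split: if_splits)
  have "\<exists>w v. norm v \<le> 1 - (norm w)\<^sup>2 \<and> taylor_coeff f 2 = w
      \<and> taylor_coeff f 3 = v / of_real (3 - 2 * \<alpha>) + w\<^sup>2"
  proof (cases "\<alpha> = 1")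
    case True
    obtain q where holq: "q holomorphic_on \<bbbD>"
      and q: "\<And>z. norm z < 1 \<Longrightarrow> f z = z * q z" and "deriv f 0 = q 0"
      using Schwarz3[OF hol f0] by blast
    then have q0: "q 0 = 1"
      using f1 by simp
    \<comment> \<open>The affine map taking the half plane Re > 1/2 to Re > 0 and fixing 1.\<close>
    define p where "p = (\<lambda>z. 2 * q z - 1)"
    have holp: "p holomorphic_on \<bbbD>"
      unfolding p_def by (intro holomorphic_intros holq)
    have "Re (p z) \<ge> 0" if "z \<in> \<bbbD>" for z
    proof (cases "z = 0")
      case False
      then have "Re (f z / z) > 1 / 2"
        using f True that by (auto simp: prestarlike_def)
      then show ?thesis
        using q[of z] that False by (simp add: p_def)
    qed (simp add: p_def q0)
    then obtain w v where wv: "norm v \<le> 1 - (norm w)\<^sup>2"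
      "taylor_coeff p 1 = 2 * w" "taylor_coeff p 2 = 2 * (v + w\<^sup>2)"
      by (rule Caratheodory_coeffs[OF holp, rotated]) (simp_all add: p_def q0)
    define P where "P = Abs_fps (taylor_coeff p)"
    have exP: "p has_fps_expansion P"
      unfolding P_def by (rule has_fps_expansion_taylor[OF holp])
    have "Abs_fps (taylor_coeff f) = fps_X * (fps_const (1 / 2) * (P + 1))"
    proof (rule fps_eq_on_disk[OF has_fps_expansion_taylor[OF hol]])
      show "(\<lambda>z. z * (1 / 2 * (p z + 1))) has_fps_expansion fps_X * (fps_const (1 / 2) * (P + 1))"
        by (intro fps_expansion_intros exP)
    qed (use q in \<open>simp add: p_def\<close>)
    then have nth: "taylor_coeff f n = fps_nth (fps_X * (fps_const (1 / 2) * (P + 1))) n" for n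
      by (simp add: fps_eq_iff)
    have "taylor_coeff f 2 = 1 / 2 * taylor_coeff p 1" "taylor_coeff f 3 = 1 / 2 * taylor_coeff p 2"
      using nth[of 2] nth[of 3] by (simp_all add: P_def)
    moreover have half: "1 / 2 * (2 * x) = x" for x :: complex
      by simp
    ultimately have "taylor_coeff f 2 = w" "taylor_coeff f 3 = v / of_real (3 - 2 * \<alpha>) + w\<^sup>2"
      unfolding wv(2,3) half by (simp_all add: True)
    with wv(1) show ?thesis by blast
  next
    case False
    define \<beta> :: complex where "\<beta> = of_real (1 - \<alpha>)"
    have \<beta>': "of_real (3 - 2 * \<alpha>) = 1 + 2 * \<beta>"
      by (simp add: \<beta>_def)
    have \<beta>: "\<beta> \<noteq> 0" "1 + 2 * \<beta> \<noteq> 0"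
      unfolding \<beta>'[symmetric] unfolding \<beta>_def of_real_eq_0_iff using \<alpha> False by auto
    let ?g = "\<lambda>z. z / (1 - z) powr complex_of_real (2 - 2 * \<alpha>)"
    have e: "complex_of_real (2 - 2 * \<alpha>) = 2 * \<beta>"
      by (simp add: \<beta>_def)
    have st: "hadamard_prod f ?g \<in> starlike_order \<alpha>"
      using f False by (simp add: prestarlike_def)
    have c: "taylor_coeff (hadamard_prod f ?g) n = taylor_coeff f n * fps_nth (koebe_fps (2 * \<beta>)) n" for n
      using taylor_coeff_hadamard_prod[OF has_fps_expansion_taylor[OF hol] has_fps_expansion_koebe]
      unfolding e by simp
    have "\<alpha> < 1"
      using \<alpha> False by simp
    then obtain w v where wv: "norm v \<le> 1 - (norm w)\<^sup>2"
      "taylor_coeff (hadamard_prod f ?g) 2 = 2 * \<beta> * w"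
      "taylor_coeff (hadamard_prod f ?g) 3 = \<beta> * (v + (1 + 2 * \<beta>) * w\<^sup>2)"
      by (rule starlike_order_coeffs[OF st, folded \<beta>_def])
    have a2: "taylor_coeff f 2 = w"
      using wv(2) \<beta> unfolding c koebe_fps_nth_2 by simp
    \<comment> \<open>The kernel coefficient \<open>c * (c + 1) / 2\<close> at
      \<open>c = 2 * \<beta>\<close>. Its factor \<open>1 + 2 * \<beta>\<close>, which is
      \<open>3 - 2 * \<alpha>\<close>, cancels against the one at \<open>w^2\<close> and stays as
      denominator of \<open>v\<close>.\<close>
    have "2 * \<beta> * (2 * \<beta> + 1) / 2 = \<beta> * (1 + 2 * \<beta>)"
      by (simp add: add.commute)
    then have "taylor_coeff f 3 * (\<beta> * (1 + 2 * \<beta>)) = \<beta> * (v + (1 + 2 * \<beta>) * w\<^sup>2)"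
      using wv(3) unfolding c koebe_fps_nth_3 by (simp only:)
    then have "taylor_coeff f 3 * (1 + 2 * \<beta>) = v + (1 + 2 * \<beta>) * w\<^sup>2"
      by (simp only: mult.left_commute mult_left_cancel[OF \<beta>(1)])
    then have "taylor_coeff f 3 = v / of_real (3 - 2 * \<alpha>) + w\<^sup>2"
      unfolding \<beta>' using \<beta>(2) by (simp add: field_simps)
    with wv(1) a2 show ?thesis by blast
  qed
  then obtain w v where "norm v \<le> 1 - (norm w)\<^sup>2" "taylor_coeff f 2 = w"
    "taylor_coeff f 3 = v / of_real (3 - 2 * \<alpha>) + w\<^sup>2" by blast
  with \<alpha> show ?thesis
    by (simp add: norm_divide divide_right_mono del: of_real_diff of_real_mult)
qed

section \<open>Extremal functions\<close>

text \<open>The claim amounts to \<open>(norm (1 - z))^2 < 2 * (1 - Re z)\<close>, which rearranges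
  to \<open>(norm z)^2 < 1\<close>.\<close>

lemma Re_inverse_one_minus_gt:
  assumes "norm z < 1"
  shows "Re (1 / (1 - z)) > 1 / 2"
proof -
  have "(norm z)\<^sup>2 < 1"
    using assms by (simp add: abs_square_less_1)
  then have lt: "(Re z)\<^sup>2 + (Im z)\<^sup>2 < 1"
    by (simp add: cmod_power2)
  have "Re z < 1"
    using assms complex_Re_le_cmod[of z] by linarith
  then have pos: "(1 - Re z)\<^sup>2 + (Im z)\<^sup>2 > 0"
    by (simp add: add_pos_nonneg)
  have "(1 - Re z)\<^sup>2 + (Im z)\<^sup>2 < 2 * (1 - Re z)"
    using lt by (simp add: power2_eq_square algebra_simps)
  with pos show ?thesis
    by (simp add: Re_divide field_simps)
qed

text \<open>Here \<open>z h' / h = 1 + c m z^m / (1 - z^m)\<close>, and the last quotient has real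
  part above -1/2, which yields the bound \<open>1 - c m / 2 = \<alpha>\<close>. The cases
  \<open>m = 1\<close> and \<open>m = 2\<close> serve the two extremal functions. A formula for
  \<open>h\<close> on the disk suffices, as Hadamard products are evaluated only there.\<close>

lemma starlike_order_binomial:
  assumes m: "m > 0" and c: "c \<ge> 0" and \<alpha>: "c * real m = 2 * (1 - \<alpha>)"
    and h: "\<And>z. z \<in> \<bbbD> \<Longrightarrow> h z = z * (1 - z ^ m) powr (- complex_of_real c)"
  shows "h \<in> starlike_order \<alpha>"
proof -
  let ?k = "\<lambda>z. z * (1 - z ^ m) powr (- complex_of_real c)"
  let ?D = "\<lambda>z. (1 + of_real (c * m) * (z ^ m / (1 - z ^ m))) * (1 - z ^ m) powr (- complex_of_real c)"
  have lt: "norm (z ^ m) < 1" if "z \<in> \<bbbD>" for z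
    using that m by (simp add: norm_power power_less_one_iff)
  have "Re (1 - z ^ m) > 0" if "z \<in> \<bbbD>" for z
    using lt[OF that] complex_Re_le_cmod[of "z ^ m"] by simp
  then have nonpos: "1 - z ^ m \<notin> \<real>\<^sub>\<le>\<^sub>0" if "z \<in> \<bbbD>" for z
    using that by (force simp: complex_nonpos_Reals_iff)
  have nz: "1 - z ^ m \<noteq> 0" if "z \<in> \<bbbD>" for z
    using nonpos[OF that] by auto
  have D: "(h has_field_derivative ?D z) (at z)" if z: "z \<in> \<bbbD>" for z
  proof (rule has_field_derivative_transform_within_open[of ?k _ _ "\<bbbD>"])
    obtain j where j: "m = Suc j"
      using m by (cases m) auto
    have "(?k has_field_derivative
        (1 - z ^ m) powr (- complex_of_real c) + z * (- of_real c *
          (1 - z ^ m) powr (- complex_of_real c - 1) * (- (of_nat m * z ^ (m - 1))))) (at z)"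
      using nonpos[OF z] by (auto intro!: derivative_eq_intros has_field_derivative_powr)
    also have "(1 - z ^ m) powr (- complex_of_real c) + z * (- of_real c *
          (1 - z ^ m) powr (- complex_of_real c - 1) * (- (of_nat m * z ^ (m - 1)))) = ?D z"
      using nz[OF z] by (simp add: powr_diff j field_simps)
    finally show "(?k has_field_derivative ?D z) (at z)" .
  qed (use z h in auto)
  have "deriv h z = ?D z" if "z \<in> \<bbbD>" for z
    by (rule DERIV_imp_deriv[OF D[OF that]])
  moreover have "h holomorphic_on \<bbbD>"
    unfolding holomorphic_on_open[OF open_ball] using D by blast
  moreover have "Re (1 + of_real (c * m) * (z ^ m / (1 - z ^ m))) \<ge> \<alpha>" if z: "z \<in> \<bbbD>" for z
  proof -
    have "z ^ m / (1 - z ^ m) = 1 / (1 - z ^ m) - 1"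
      using nz[OF z] by (simp add: field_simps)
    then have "Re (z ^ m / (1 - z ^ m)) \<ge> - 1 / 2"
      using Re_inverse_one_minus_gt[OF lt[OF z]] by simp
    then have ge: "(c * m) * Re (z ^ m / (1 - z ^ m)) \<ge> (c * m) * (- 1 / 2)"
      using c by (intro mult_left_mono) auto
    have "Re (1 + of_real a * x) = 1 + a * Re x" for a x
      by simp
    moreover have "\<alpha> \<le> 1 + 2 * (1 - \<alpha>) * x" if "2 * (1 - \<alpha>) * x \<ge> 2 * (1 - \<alpha>) * (- 1 / 2)" for x
      using that by (simp add: algebra_simps)
    ultimately show ?thesis
      using ge unfolding \<alpha> by metis
  qed
  ultimately show ?thesis
    using h nz m by (auto simp: starlike_order_def class_A_def zero_power)
qed

lemma class_A_fps:
  assumes "f has_fps_expansion F" "fps_nth F 0 = 0" "fps_nth F 1 = 1" "f holomorphic_on \<bbbD>"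
  shows "f \<in> class_A"
  using assms taylor_coeff_eqI[OF assms(1), of 0] taylor_coeff_eqI[OF assms(1), of 1]
    taylor_coeff_1[of f]
  by (simp add: class_A_def taylor_coeff_0)

text \<open>The neutral element of the Hadamard product among series without constant term.\<close>

definition geo_fps :: "complex fps" where
  "geo_fps = Abs_fps (\<lambda>n. if n = 0 then 0 else 1)"

lemma has_fps_expansion_geo: "(\<lambda>z. z / (1 - z)) has_fps_expansion geo_fps"
proof (rule has_fps_expansionI, rule eventually_nhds_disk)
  fix z :: complex assume "z \<in> \<bbbD>"
  then have "(\<lambda>n. z * z ^ n) sums (z * (1 / (1 - z)))"
    by (intro sums_mult geometric_sums) simp
  then have "(\<lambda>n. fps_nth geo_fps (Suc n) * z ^ Suc n) sums (z / (1 - z))"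
    by (simp add: geo_fps_def)
  then show "(\<lambda>n. fps_nth geo_fps n * z ^ n) sums (z / (1 - z))"
    by (subst (asm) sums_Suc_iff) (simp add: geo_fps_def)
qed

text \<open>The extremal function for \<open>\<phi> = 1\<close>. Its Hadamard product with the
  kernel is the kernel itself, which is starlike by the case \<open>m = 1\<close>.\<close>

lemma geo_prestarlike:
  assumes "0 \<le> \<alpha>" "\<alpha> \<le> 1"
  shows "(\<lambda>z. z / (1 - z)) \<in> prestarlike \<alpha>"
proof -
  have A: "(\<lambda>z. z / (1 - z)) \<in> class_A"
    by (rule class_A_fps[OF has_fps_expansion_geo])
       (auto simp: geo_fps_def intro!: holomorphic_intros)
  show ?thesis
  proof (cases "\<alpha> = 1")
    case True
    then show ?thesis
      using A Re_inverse_one_minus_gt by (auto simp: prestarlike_def)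
  next
    case False
    define c where "c = complex_of_real (2 - 2 * \<alpha>)"
    have "hadamard_prod (\<lambda>z. z / (1 - z)) (\<lambda>z. z / (1 - z) powr c) z = z * (1 - z) powr - c"
      if z: "z \<in> \<bbbD>" for z
    proof -
      have "(\<lambda>n. z * (pochhammer c n / fact n * z ^ n)) sums (z * (1 - z) powr - c)"
        using z by (intro sums_mult one_minus_powr_sums) simp
      then have "(\<lambda>n. fps_nth geo_fps (Suc n) * fps_nth (koebe_fps c) (Suc n) * z ^ Suc n)
          sums (z * (1 - z) powr - c)"
        by (simp add: geo_fps_def mult_ac)
      then have "(\<lambda>n. fps_nth geo_fps n * fps_nth (koebe_fps c) n * z ^ n) sums (z * (1 - z) powr - c)"
        by (subst (asm) sums_Suc_iff) simp
      then show ?thesis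
        by (simp add: hadamard_prod_def taylor_coeff_eqI[OF has_fps_expansion_geo]
            taylor_coeff_eqI[OF has_fps_expansion_koebe] sums_iff)
    qed
    then have "hadamard_prod (\<lambda>z. z / (1 - z)) (\<lambda>z. z / (1 - z) powr c) \<in> starlike_order \<alpha>"
      unfolding c_def using assms
      by (intro starlike_order_binomial[of 1 "2 - 2 * \<alpha>"]) (auto simp: algebra_simps)
    then show ?thesis
      using A False by (simp add: prestarlike_def c_def)
  qed
qed

text \<open>
  The extremal function for \<open>\<phi> = z\<close>, that is, the preimage of
  \<open>z / (1 - z\<^sup>2) powr (1 - \<alpha>)\<close> under Hadamard multiplication by \<open>z / (1 - z) powr (2 - 2 * \<alpha>)\<close>; the duplication formula for Pochhammer symbols
  brings the quotients of the coefficients into the form below.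
\<close>
definition odd_fps :: "real \<Rightarrow> complex fps" where
  "odd_fps \<alpha> = Abs_fps (\<lambda>n. if odd n then
     of_real (pochhammer (1 / 2) (n div 2) / pochhammer (3 / 2 - \<alpha>) (n div 2)) else 0)"

text \<open>As \<open>3 / 2 - \<alpha>\<close> is at least 1/2, each factor of the numerator is at
  most the matching one below it. This gives convergence on the whole disk.\<close>

lemma norm_odd_fps_le:
  assumes "\<alpha> \<le> 1"
  shows "norm (fps_nth (odd_fps \<alpha>) n) \<le> 1"
proof -
  define k where "k = n div 2"
  have pos: "pochhammer (1 / 2 :: real) k > 0"
    by (intro pochhammer_pos) simp
  have "pochhammer (1 / 2) k \<le> pochhammer (3 / 2 - \<alpha>) k"
    unfolding pochhammer_prod by (intro prod_mono) (use assms in auto)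
  with pos have "\<bar>pochhammer (1 / 2) k / pochhammer (3 / 2 - \<alpha>) k\<bar> \<le> 1"
    by simp
  then show ?thesis
    unfolding odd_fps_def fps_nth_Abs_fps k_def[symmetric]
    by (simp del: of_real_divide)
qed

lemma fps_conv_radius_odd_fps:
  assumes "\<alpha> \<le> 1"
  shows "fps_conv_radius (odd_fps \<alpha>) \<ge> 1"
  unfolding fps_conv_radius_def
proof (rule conv_radius_geI_ex')
  fix r :: real assume r: "0 < r" "ereal r < 1"
  show "summable (\<lambda>n. fps_nth (odd_fps \<alpha>) n * of_real r ^ n)"
  proof (rule summable_comparison_test')
    show "summable (\<lambda>n. r ^ n)"
      using r by (intro summable_geometric) simp
    show "norm (fps_nth (odd_fps \<alpha>) n * of_real r ^ n) \<le> r ^ n" for n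
      using norm_odd_fps_le[OF assms, of n] r by (simp add: norm_mult norm_power mult_left_le_one_le)
  qed
qed

lemma has_fps_expansion_odd_fps:
  assumes "\<alpha> \<le> 1"
  shows "eval_fps (odd_fps \<alpha>) has_fps_expansion odd_fps \<alpha>"
  using less_le_trans[OF _ fps_conv_radius_odd_fps[OF assms], of 0]
  by (intro eval_fps_has_fps_expansion) simp

text \<open>Reduces an odd series to one in z^2, to which the geometric or binomial series
  applies.\<close>

lemma odd_sums:
  fixes z :: complex
  assumes "(\<lambda>k. a (2 * k + 1) * (z\<^sup>2) ^ k) sums s" "\<And>n. even n \<Longrightarrow> a n = 0"
  shows "(\<lambda>n. a n * z ^ n) sums (z * s)"
proof -
  have "(\<lambda>k. z * (a (2 * k + 1) * (z\<^sup>2) ^ k)) sums (z * s)"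
    by (rule sums_mult[OF assms(1)])
  then have "(\<lambda>k. a (2 * k + 1) * z ^ (2 * k + 1)) sums (z * s)"
    by (simp add: power_mult mult.left_commute)
  moreover have "a n * z ^ n = 0" if "n \<notin> range (\<lambda>k. 2 * k + 1)" for n
  proof -
    have "even n"
    proof (rule ccontr)
      assume "odd n"
      then obtain k where "n = 2 * k + 1"
        by (rule oddE)
      with that show False
        by blast
    qed
    then show ?thesis
      by (simp add: assms(2))
  qed
  moreover have "strict_mono (\<lambda>k :: nat. 2 * k + 1)"
    by (simp add: strict_mono_def)
  ultimately show ?thesis
    using sums_mono_reindex[of "\<lambda>k. 2 * k + 1" "\<lambda>n. a n * z ^ n"] by blast
qed

text \<open>For \<open>\<alpha> = 1\<close> the Pochhammer quotients are all 1 and the function is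
  \<open>z / (1 - z^2)\<close>. Otherwise its product with the kernel is the case
  \<open>m = 2\<close> of the binomial family.\<close>

lemma odd_prestarlike:
  assumes "0 \<le> \<alpha>" "\<alpha> \<le> 1"
  shows "eval_fps (odd_fps \<alpha>) \<in> prestarlike \<alpha>"
proof -
  note ex = has_fps_expansion_odd_fps[OF assms(2)]
  have A: "eval_fps (odd_fps \<alpha>) \<in> class_A"
  proof (rule class_A_fps[OF ex])
    show "eval_fps (odd_fps \<alpha>) holomorphic_on \<bbbD>"
      using ball_eball_mono[of 1] fps_conv_radius_odd_fps[OF assms(2)]
      by (intro holomorphic_intros) (simp add: one_ereal_def)
  qed (auto simp: odd_fps_def)
  have sq: "norm (z\<^sup>2) < 1" if "z \<in> \<bbbD>" for z
    using that by (simp add: norm_power abs_square_less_1)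
  have pos: "pochhammer x k > 0" if "x > 0" for x :: real and k
    using that by (rule pochhammer_pos)
  show ?thesis
  proof (cases "\<alpha> = 1")
    case True
    have "eval_fps (odd_fps \<alpha>) z / z = 1 / (1 - z\<^sup>2)" if z: "z \<in> \<bbbD> - {0}" for z
    proof -
      have "(\<lambda>n. fps_nth (odd_fps \<alpha>) n * z ^ n) sums (z * (1 / (1 - z\<^sup>2)))"
      proof (rule odd_sums)
        have "pochhammer (1 / 2 :: real) k \<noteq> 0" for k
          using pos[of "1 / 2" k] by simp
        then show "(\<lambda>k. fps_nth (odd_fps \<alpha>) (2 * k + 1) * (z\<^sup>2) ^ k) sums (1 / (1 - z\<^sup>2))"
          using geometric_sums[OF sq[of z]] z True by (simp add: odd_fps_def)
      qed (simp add: odd_fps_def)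
      then show ?thesis
        using z by (simp add: eval_fps_def sums_iff)
    qed
    then show ?thesis
      using A Re_inverse_one_minus_gt[OF sq] True by (simp add: prestarlike_def)
  next
    case False
    define \<beta> :: complex where "\<beta> = of_real (1 - \<alpha>)"
    have e: "complex_of_real (2 - 2 * \<alpha>) = 2 * \<beta>"
      by (simp add: \<beta>_def)
    have "hadamard_prod (eval_fps (odd_fps \<alpha>)) (\<lambda>z. z / (1 - z) powr (2 * \<beta>)) z
        = z * (1 - z\<^sup>2) powr - \<beta>" if z: "z \<in> \<bbbD>" for z
    proof -
      \<comment> \<open>Duplication gives \<open>4^k (\<beta>)_k (\<beta> + 1/2)_k\<close> for the
        kernel's numerator and \<open>4^k (1/2)_k k!\<close> for \<open>(2k)!\<close>; the
        coefficients of \<open>odd_fps\<close> cancel both half-integer shifts.\<close>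
      have "fps_nth (odd_fps \<alpha>) (2 * k + 1) * fps_nth (koebe_fps (2 * \<beta>)) (2 * k + 1)
          = pochhammer \<beta> k / fact k" for k
      proof -
        have b: "of_real (pochhammer (3 / 2 - \<alpha>) k) = pochhammer (\<beta> + 1 / 2) k"
          by (simp add: \<beta>_def flip: pochhammer_of_real)
        have h: "of_real (pochhammer (1 / 2) k) = pochhammer (1 / 2 :: complex) k"
          by (simp flip: pochhammer_of_real)
        have "pochhammer (\<beta> + 1 / 2) k \<noteq> 0" "pochhammer (1 / 2 :: complex) k \<noteq> 0"
          unfolding b[symmetric] h[symmetric] of_real_eq_0_iff
          using pos[of "3 / 2 - \<alpha>" k] pos[of "1 / 2" k] assms by simp_all
        then show ?thesis
          by (simp add: odd_fps_def b h pochhammer_double fact_double)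
      qed
      then have "(\<lambda>n. fps_nth (odd_fps \<alpha>) n * fps_nth (koebe_fps (2 * \<beta>)) n * z ^ n)
          sums (z * (1 - z\<^sup>2) powr - \<beta>)"
        using one_minus_powr_sums[OF sq[OF z], of \<beta>]
        by (intro odd_sums) (simp_all add: odd_fps_def)
      then show ?thesis
        by (simp add: hadamard_prod_def taylor_coeff_eqI[OF ex]
            taylor_coeff_eqI[OF has_fps_expansion_koebe] sums_iff)
    qed
    then have "hadamard_prod (eval_fps (odd_fps \<alpha>)) (\<lambda>z. z / (1 - z) powr (2 * \<beta>)) \<in> starlike_order \<alpha>"
      unfolding \<beta>_def using assms
      by (intro starlike_order_binomial[of 2 "1 - \<alpha>"]) (auto simp: algebra_simps)
    then show ?thesis
      using A False by (simp add: prestarlike_def e[symmetric])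
  qed
qed

theorem theorem6p3:
  fixes \<alpha> :: real and lam :: complex
  assumes "0 \<le> \<alpha>" and "\<alpha> \<le> 1"
  shows "(\<exists>f\<in>prestarlike \<alpha>. norm (fekete_szego f lam) = max (1 / (3 - 2 * \<alpha>)) (norm (lam - 1)))
       \<and> (\<forall>f\<in>prestarlike \<alpha>. norm (fekete_szego f lam) \<le> max (1 / (3 - 2 * \<alpha>)) (norm (lam - 1)))"
proof (intro conjI ballI)
  \<comment> \<open>Both coefficients are 1 here, so the functional equals \<open>1 - lam\<close>;
    for the odd function below the second coefficient vanishes and only the third
    contributes.\<close>
  have "norm (fekete_szego (\<lambda>z. z / (1 - z)) lam) = norm (lam - 1)"
    by (simp add: fekete_szego_def taylor_coeff_eqI[OF has_fps_expansion_geo] geo_fps_def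
        norm_minus_commute)
  moreover have "norm (fekete_szego (eval_fps (odd_fps \<alpha>)) lam) = 1 / (3 - 2 * \<alpha>)"
  proof -
    have "fekete_szego (eval_fps (odd_fps \<alpha>)) lam = of_real ((1 / 2) / (3 / 2 - \<alpha>))"
      unfolding fekete_szego_def taylor_coeff_eqI[OF has_fps_expansion_odd_fps[OF assms(2)]]
      by (simp add: odd_fps_def)
    also have "norm \<dots> = 1 / (3 - 2 * \<alpha>)"
      unfolding norm_of_real using assms by (simp add: field_simps)
    finally show ?thesis .
  qed
  ultimately show "\<exists>f\<in>prestarlike \<alpha>. norm (fekete_szego f lam)
      = max (1 / (3 - 2 * \<alpha>)) (norm (lam - 1))"
    using geo_prestarlike[OF assms] odd_prestarlike[OF assms] unfolding max_def by metis
next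
  fix f assume f: "f \<in> prestarlike \<alpha>"
  define w where "w = taylor_coeff f 2"
  define M where "M = max (1 / (3 - 2 * \<alpha>)) (norm (lam - 1))"
  have le: "norm (taylor_coeff f 3 - w\<^sup>2) \<le> (1 - (norm w)\<^sup>2) * (1 / (3 - 2 * \<alpha>))"
    using prestarlike_coeffs[OF f assms(2)] by (simp add: w_def)
  \<comment> \<open>The inequality itself forces \<open>norm w <= 1\<close>, so the weights of the
    convex combination below are nonnegative.\<close>
  have "0 \<le> (1 - (norm w)\<^sup>2) * (1 / (3 - 2 * \<alpha>))"
    by (rule order_trans[OF norm_ge_zero le])
  then have w: "(norm w)\<^sup>2 \<le> 1"
    using assms by (simp add: zero_le_divide_iff)
  have "fekete_szego f lam = (taylor_coeff f 3 - w\<^sup>2) - (lam - 1) * w\<^sup>2"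
    by (simp add: fekete_szego_def w_def algebra_simps)
  then have "norm (fekete_szego f lam) \<le> norm (taylor_coeff f 3 - w\<^sup>2) + (norm w)\<^sup>2 * norm (lam - 1)"
    using norm_triangle_ineq4[of "taylor_coeff f 3 - w\<^sup>2" "(lam - 1) * w\<^sup>2"]
    by (simp add: norm_mult norm_power mult.commute)
  also have "\<dots> \<le> (1 - (norm w)\<^sup>2) * M + (norm w)\<^sup>2 * M"
    using w by (intro add_mono order_trans[OF le] mult_left_mono) (auto simp: M_def)
  finally show "norm (fekete_szego f lam) \<le> max (1 / (3 - 2 * \<alpha>)) (norm (lam - 1))"
    by (simp add: M_def algebra_simps)
qed

end
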